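(* Let $I,J\subset\mathbb{R}$ be nonempty open intervals, let $f:I\to\mathbb{R}$ and $g:J\to\mathbb{R}$ be smooth, and let $M$ be the Type II translation surface in Minkowski space $\mathbb{R}^3_1$ parametrized by $\mathcal{F}(u,v)=(u,f(u)+g(v),v)$, $(u,v)\in I\times J$. Assume $M$ is spacelike. Then $M$ is minimal with respect to the semi-symmetric non-metric connection $\overline\nabla$ if and only if $\mathcal{F}$ is of one of the following forms on $I\times J$: (i) $\mathcal{F}(u,v)=(u,\ c_1u+c_2v+c_3,\ v)$ for some real constants $c_1,c_2,c_3$; (ii) $\mathcal{F}(u,v)=\Big(u,\ \frac{1}{c_0}\ln\frac{|e^{c_0v}-c_3e^{-c_0v}|}{|\cos(c_0u+c_4)|}+b,\ v\Big)$ for some real constants $b,c_0,c_3,c_4$ with $c_0,c_3\neq0$ (with $\cos(c_0u+c_4)$ nonvanishing on $I$ and $e^{c_0v}-c_3e^{-c_0v}$ nonvanishing on $J$).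
   Context: $\mathbb{R}^3_1$ is $\mathbb{R}^3$ with the Minkowski metric $\widetilde g_1=dx^2+dy^2-dz^2$, coordinate fields $X_1=\partial_x$, $X_2=\partial_y$, $X_3=\partial_z$ and Levi-Civita connection $\nabla^L$ (so $\nabla^L_{X_i}X_j=0$). The semi-symmetric non-metric connection $\overline\nabla$ is $$\overline\nabla_XY=\nabla^L_XY+\widetilde g_1(Y,X_3)X .$$ A surface is spacelike if the metric induced on it by $\widetilde g_1$ is Riemannian (positive definite). For a spacelike surface $M$ parametrized by $\mathcal{F}(u,v)$, put $E_1=\mathcal{F}_u$, $E_2=\mathcal{F}_v$, let $N$ be a unit (timelike) normal field, $\widetilde g_1(N,N)=-1$, and let $E=\widetilde g_1(\mathcal{F}_u,\mathcal{F}_u)$, $F=\widetilde g_1(\mathcal{F}_u,\mathcal{F}_v)$, $G=\widetilde g_1(\mathcal{F}_v,\mathcal{F}_v)$. $M$ is minimal with respect to $\overline\nabla$ if its mean curvature with respect to $\overline\nabla$ vanishes everywhere, i.e. $$G\,\widetilde g_1(\overline\nabla_{E_1}E_1,N)-F\,\widetilde g_1(\overline\nabla_{E_1}E_2,N)-F\,\widetilde g_1(\overline\nabla_{E_2}E_1,N)+E\,\widetilde g_1(\overline\nabla_{E_2}E_2,N)=0 .$$ *)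

theory Defs
  imports "HOL-Analysis.Analysis"
begin

(* For open S, this says that f is C-infinity on S and only depends on f restricted to S. *)
definition smooth_on :: "real set \<Rightarrow> (real \<Rightarrow> real) \<Rightarrow> bool" where
  "smooth_on S f \<longleftrightarrow> (\<forall>n. \<forall>x\<in>S. (deriv ^^ n) f differentiable at x)"

definition mink :: "real^3 \<Rightarrow> real^3 \<Rightarrow> real" where
  "mink a b = a $ 1 * b $ 1 + a $ 2 * b $ 2 - a $ 3 * b $ 3"

definition X3 :: "real^3" where
  "X3 = vector [0, 0, 1]"

(* The metric has constant coefficients in the frame of coordinate fields, so its Levi-Civita
   connection differentiates components: (nablaL X Y) at p is the derivative of Y along X p. *)
definition nablaL :: "(real^3 \<Rightarrow> real^3) \<Rightarrow> (real^3 \<Rightarrow> real^3) \<Rightarrow> real^3 \<Rightarrow> real^3" where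
  "nablaL X Y = (\<lambda>p. frechet_derivative Y (at p) (X p))"

definition nabla_bar :: "(real^3 \<Rightarrow> real^3) \<Rightarrow> (real^3 \<Rightarrow> real^3) \<Rightarrow> real^3 \<Rightarrow> real^3" where
  "nabla_bar X Y = (\<lambda>p. nablaL X Y p + mink (Y p) X3 *\<^sub>R X p)"

lemma nablaL_coordinate_fields: "nablaL (\<lambda>_. axis i 1) (\<lambda>_. axis j 1) p = 0"
  by (simp add: nablaL_def)

lemma has_derivative_mink:
  assumes "(Y has_derivative Y') (at p)" "(Z has_derivative Z') (at p)"
  shows "((\<lambda>q. mink (Y q) (Z q)) has_derivative (\<lambda>h. mink (Y' h) (Z p) + mink (Y p) (Z' h))) (at p)"
  unfolding mink_def
  by (rule has_derivative_eq_rhs, (rule derivative_intros assms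
        bounded_linear.has_derivative[OF bounded_linear_vec_nth])+) (simp add: algebra_simps)

lemma nablaL_metric:
  assumes "Y differentiable at p" "Z differentiable at p"
  shows "frechet_derivative (\<lambda>q. mink (Y q) (Z q)) (at p) (X p)
       = mink (nablaL X Y p) (Z p) + mink (Y p) (nablaL X Z p)"
  using frechet_derivative_at[OF has_derivative_mink[OF
      assms[unfolded frechet_derivative_works]], THEN fun_cong, of "X p"]
  by (simp add: nablaL_def)

(* A vector field along F :: real \<times> real \<Rightarrow> real^3 is a map W of the same type.  A direction d of
   the parameter plane gives the tangent field (tangent F d); E1 and E2 are the cases
   d = (1, 0) and d = (0, 1). *)
definition tangent :: "(real \<times> real \<Rightarrow> real^3) \<Rightarrow> real \<times> real \<Rightarrow> real \<times> real \<Rightarrow> real^3" where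
  "tangent F d = (\<lambda>p. frechet_derivative F (at p) d)"

abbreviation E1 :: "(real \<times> real \<Rightarrow> real^3) \<Rightarrow> real \<times> real \<Rightarrow> real^3" where
  "E1 F \<equiv> tangent F (1, 0)"

abbreviation E2 :: "(real \<times> real \<Rightarrow> real^3) \<Rightarrow> real \<times> real \<Rightarrow> real^3" where
  "E2 F \<equiv> tangent F (0, 1)"

(* nabla_bar for fields W that are only given along F; lemma nabla_bar_along_restrict shows that
   this is the value of nabla_bar on any extensions to the ambient space. *)
definition nabla_bar_along ::
  "(real \<times> real \<Rightarrow> real^3) \<Rightarrow> real \<times> real \<Rightarrow> (real \<times> real \<Rightarrow> real^3) \<Rightarrow> real \<times> real \<Rightarrow> real^3" where
  "nabla_bar_along F d W =
     (\<lambda>p. frechet_derivative W (at p) d + mink (W p) X3 *\<^sub>R tangent F d p)"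

lemma nabla_bar_along_restrict:
  assumes "F differentiable at p" "Y differentiable at (F p)"
    and "X (F p) = tangent F d p"
    and "open U" "p \<in> U" "\<And>q. q \<in> U \<Longrightarrow> W q = Y (F q)"
  shows "nabla_bar_along F d W p = nabla_bar X Y (F p)"
proof -
  have "((\<lambda>q. Y (F q)) has_derivative
      (\<lambda>h. frechet_derivative Y (at (F p)) (frechet_derivative F (at p) h))) (at p)"
    using diff_chain_at[OF assms(1,2)[unfolded frechet_derivative_works]] by (simp add: o_def)
  then have "(W has_derivative
      (\<lambda>h. frechet_derivative Y (at (F p)) (frechet_derivative F (at p) h))) (at p)"
    by (rule has_derivative_transform_within_open[OF _ assms(4,5)]) (simp add: assms(6))
  from frechet_derivative_at[OF this, symmetric] show ?thesis
    using assms by (simp add: nabla_bar_along_def nabla_bar_def nablaL_def tangent_def)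
qed

definition coeff_E :: "(real \<times> real \<Rightarrow> real^3) \<Rightarrow> real \<times> real \<Rightarrow> real" where
  "coeff_E F p = mink (E1 F p) (E1 F p)"

definition coeff_F :: "(real \<times> real \<Rightarrow> real^3) \<Rightarrow> real \<times> real \<Rightarrow> real" where
  "coeff_F F p = mink (E1 F p) (E2 F p)"

definition coeff_G :: "(real \<times> real \<Rightarrow> real^3) \<Rightarrow> real \<times> real \<Rightarrow> real" where
  "coeff_G F p = mink (E2 F p) (E2 F p)"

definition spacelike_on :: "(real \<times> real \<Rightarrow> real^3) \<Rightarrow> (real \<times> real) set \<Rightarrow> bool" where
  "spacelike_on F D \<longleftrightarrow> (\<forall>p\<in>D. \<forall>a b. (a, b) \<noteq> (0, 0) \<longrightarrow>
     mink (a *\<^sub>R E1 F p + b *\<^sub>R E2 F p) (a *\<^sub>R E1 F p + b *\<^sub>R E2 F p) > 0)"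

(* No regularity of N is imposed: only the values of N enter the mean curvature condition,
   and at each point they are determined up to sign. *)
definition unit_normal_field ::
  "(real \<times> real \<Rightarrow> real^3) \<Rightarrow> (real \<times> real) set \<Rightarrow> (real \<times> real \<Rightarrow> real^3) \<Rightarrow> bool" where
  "unit_normal_field F D N \<longleftrightarrow> (\<forall>p\<in>D.
     mink (N p) (E1 F p) = 0 \<and> mink (N p) (E2 F p) = 0 \<and> mink (N p) (N p) = -1)"

lemma spacelike_imp_unit_normal_field:
  assumes "spacelike_on F D"
  shows "\<exists>N. unit_normal_field F D N"
proof -
  have "\<exists>n. mink n (E1 F p) = 0 \<and> mink n (E2 F p) = 0 \<and> mink n n = -1" if p: "p \<in> D" for p
  proof -
    define a b where "a = E1 F p" and "b = E2 F p"
    define e h g where "e = mink a a" and "h = mink a b" and "g = mink b b"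
    have pos: "mink (x *\<^sub>R a + y *\<^sub>R b) (x *\<^sub>R a + y *\<^sub>R b) > 0" if "(x, y) \<noteq> (0, 0)" for x y
      using assms p that unfolding spacelike_on_def a_def b_def by blast
    have e: "e > 0" using pos[of 1 0] by (simp add: e_def)
    have "e * (e * g - h\<^sup>2) = mink ((- h) *\<^sub>R a + e *\<^sub>R b) ((- h) *\<^sub>R a + e *\<^sub>R b)"
      by (simp add: e_def h_def g_def mink_def power2_eq_square algebra_simps)
    moreover have "mink ((- h) *\<^sub>R a + e *\<^sub>R b) ((- h) *\<^sub>R a + e *\<^sub>R b) > 0"
      using e by (intro pos) simp
    ultimately have W: "e * g - h\<^sup>2 > 0"
      using e by (metis zero_less_mult_pos)
    define w :: "real^3" where "w = vector [a $ 2 * b $ 3 - a $ 3 * b $ 2,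
      a $ 3 * b $ 1 - a $ 1 * b $ 3, a $ 2 * b $ 1 - a $ 1 * b $ 2]"
    have w: "mink w a = 0" "mink w b = 0" "mink w w = - (e * g - h\<^sup>2)"
      by (simp_all add: w_def e_def h_def g_def mink_def power2_eq_square algebra_simps)
    define n where "n = (1 / sqrt (e * g - h\<^sup>2)) *\<^sub>R w"
    have sc: "mink (k *\<^sub>R x) y = k * mink x y" "mink x (k *\<^sub>R y) = k * mink x y" for k x y
      by (simp_all add: mink_def algebra_simps)
    have "mink n n = -1" using W by (simp add: n_def sc w real_sqrt_mult_self field_simps)
    then show ?thesis unfolding a_def[symmetric] b_def[symmetric]
      by (intro exI[of _ n]) (simp add: n_def sc w)
  qed
  then show ?thesis unfolding unit_normal_field_def by metis
qed

definition minimal_nabla_bar ::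
  "(real \<times> real \<Rightarrow> real^3) \<Rightarrow> (real \<times> real) set \<Rightarrow> (real \<times> real \<Rightarrow> real^3) \<Rightarrow> bool" where
  "minimal_nabla_bar F D N \<longleftrightarrow> (\<forall>p\<in>D.
       coeff_G F p * mink (nabla_bar_along F (1, 0) (E1 F) p) (N p)
     - coeff_F F p * mink (nabla_bar_along F (1, 0) (E2 F) p) (N p)
     - coeff_F F p * mink (nabla_bar_along F (0, 1) (E1 F) p) (N p)
     + coeff_E F p * mink (nabla_bar_along F (0, 1) (E2 F) p) (N p) = 0)"

definition translation_II :: "(real \<Rightarrow> real) \<Rightarrow> (real \<Rightarrow> real) \<Rightarrow> real \<times> real \<Rightarrow> real^3" where
  "translation_II f g = (\<lambda>(u, v). vector [u, f u + g v, v])"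

end

theory Submission
  imports Defs
begin

text \<open>
  Write \<open>f', g'\<close> for the derivatives at \<open>u\<close> and \<open>v\<close>.  The tangent frame is \<open>E1 = (1, f', 0)\<close>,
  \<open>E2 = (0, g', 1)\<close>.  The connection differs from the flat one only by multiples of the tangent
  vector along which one differentiates, and these have no normal component; moreover the mixed
  second derivatives of a translation surface vanish.  What is left of the mean curvature is the
  second component of \<open>N\<close>, which is never zero, times
  \<open>(g'\<^sup>2 - 1) f'' + (1 + f'\<^sup>2) g''\<close> (lemma \<open>minimal_translation_II_iff\<close>).

  The surface being spacelike means \<open>g'\<^sup>2 > 1 + f'\<^sup>2\<close>, so both coefficients are nonzero and
  the variables separate: for a constant \<open>k\<close>,
  \<open>f'' = k (1 + f'\<^sup>2)\<close> and \<open>g'' = - k (g'\<^sup>2 - 1)\<close>.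
  If \<open>k = 0\<close>, both functions are affine.  Otherwise these are the equations of the tangent and of the
  hyperbolic cotangent, linearised by \<open>arctan f'\<close> and by \<open>(g' - 1) / (g' + 1)\<close>;
  one more integration gives the logarithms of form (ii).  Each step is the statement that two
  functions with the same derivative on an interval differ by a constant.

  Conversely, a sum \<open>f u + g v\<close> of one of the two forms determines \<open>f'\<close> and \<open>g'\<close>, as one
  sees by freezing one variable, and they satisfy the separated equations.
\<close>

section \<open>The minimality equation\<close>

lemma has_derivative_vector_3:
  fixes a b c :: "'a::real_normed_vector \<Rightarrow> real"
  assumes "(a has_derivative a') F" "(b has_derivative b') F" "(c has_derivative c') F"
  shows "((\<lambda>p. vector [a p, b p, c p] :: real^3) has_derivative (\<lambda>h. vector [a' h, b' h, c' h])) F"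
proof -
  have "vector [x, y, z] = x *\<^sub>R axis 1 1 + y *\<^sub>R axis 2 1 + z *\<^sub>R (axis 3 1 :: real^3)" for x y z :: real
    by (simp add: vec_eq_iff forall_3 axis_def)
  then show ?thesis
    by (simp only:) (intro derivative_intros assms)
qed

lemma has_derivative_of_fst:
  assumes "(f has_real_derivative D) (at (fst p))"
  shows "((\<lambda>q :: real \<times> real. f (fst q)) has_derivative (\<lambda>h. D * fst h)) (at p)"
  using diff_chain_at[OF has_derivative_fst[OF has_derivative_ident], of f "(*) D" p]
    assms[THEN has_field_derivative_imp_has_derivative] by (simp add: o_def)

lemma has_derivative_of_snd:
  assumes "(f has_real_derivative D) (at (snd p))"
  shows "((\<lambda>q :: real \<times> real. f (snd q)) has_derivative (\<lambda>h. D * snd h)) (at p)"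
  using diff_chain_at[OF has_derivative_snd[OF has_derivative_ident], of f "(*) D" p]
    assms[THEN has_field_derivative_imp_has_derivative] by (simp add: o_def)

lemma tangent_translation_II:
  assumes "(f has_real_derivative f') (at u)" "(g has_real_derivative g') (at v)"
  shows "tangent (translation_II f g) (a, b) (u, v) = vector [a, f' * a + g' * b, b]"
proof -
  have "((\<lambda>q. vector [fst q, f (fst q) + g (snd q), snd q] :: real^3) has_derivative
      (\<lambda>h. vector [fst h, f' * fst h + g' * snd h, snd h])) (at (u, v))"
    using assms
    by (intro has_derivative_vector_3 derivative_intros has_derivative_of_fst has_derivative_of_snd) auto
  then have "(translation_II f g has_derivative
      (\<lambda>h. vector [fst h, f' * fst h + g' * snd h, snd h])) (at (u, v))"
    by (simp add: translation_II_def case_prod_unfold)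
  from frechet_derivative_at[OF this, symmetric] show ?thesis
    by (simp add: tangent_def)
qed

lemma frechet_derivative_tangent_translation_II:
  assumes "open I" "open J" "u \<in> I" "v \<in> J"
    and "\<And>x. x \<in> I \<Longrightarrow> (f has_real_derivative f' x) (at x)"
    and "\<And>y. y \<in> J \<Longrightarrow> (g has_real_derivative g' y) (at y)"
    and "(f' has_real_derivative f'') (at u)" "(g' has_real_derivative g'') (at v)"
  shows "frechet_derivative (tangent (translation_II f g) (a, b)) (at (u, v)) (s, t) =
    vector [0, f'' * s * a + g'' * t * b, 0]"
proof -
  have "((\<lambda>q. vector [a, f' (fst q) * a + g' (snd q) * b, b] :: real^3) has_derivative
      (\<lambda>h. vector [0, f'' * fst h * a + g'' * snd h * b, 0])) (at (u, v))"
    using assms(7,8)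
    by (intro has_derivative_vector_3 derivative_intros has_derivative_of_fst has_derivative_of_snd) auto
  then have "(tangent (translation_II f g) (a, b) has_derivative
      (\<lambda>h. vector [0, f'' * fst h * a + g'' * snd h * b, 0])) (at (u, v))"
    by (rule has_derivative_transform_within_open[OF _ open_Times[OF assms(1,2)]])
      (use assms in \<open>auto simp: tangent_translation_II[OF assms(5,6)]\<close>)
  from frechet_derivative_at[OF this, symmetric] show ?thesis
    by simp
qed

text \<open>
  The bound is positivity of the Gram determinant \<open>E G - F\<^sup>2 = g'\<^sup>2 - 1 - f'\<^sup>2\<close>.
\<close>

lemma spacelike_translation_II_imp:
  assumes "spacelike_on (translation_II f g) D" "(u, v) \<in> D"
    and "(f has_real_derivative f') (at u)" "(g has_real_derivative g') (at v)"
  shows "g'\<^sup>2 > 1 + f'\<^sup>2"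
proof -
  have pos: "a\<^sup>2 + (f' * a + g' * b)\<^sup>2 - b\<^sup>2 > 0" if "(a, b) \<noteq> (0, 0)" for a b
    using assms(1)[unfolded spacelike_on_def, rule_format, OF assms(2) that]
    by (simp add: tangent_translation_II[OF assms(3,4)] mink_def power2_eq_square algebra_simps)
  \<comment> \<open>The vector \<open>- F E1 + E E2\<close> is orthogonal to \<open>E1\<close>, and its square is \<open>E (E G - F\<^sup>2)\<close>.\<close>
  have "(- (f' * g'))\<^sup>2 + (f' * (- (f' * g')) + g' * (1 + f'\<^sup>2))\<^sup>2 - (1 + f'\<^sup>2)\<^sup>2 > 0"
    by (rule pos) (simp add: add_nonneg_eq_0_iff)
  then have "0 < (1 + f'\<^sup>2) * (g'\<^sup>2 - (1 + f'\<^sup>2))"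
    by (simp add: power2_eq_square algebra_simps)
  moreover have "0 < 1 + f'\<^sup>2"
    by (simp add: add_pos_nonneg)
  ultimately show ?thesis
    by (simp add: zero_less_mult_iff)
qed

text \<open>
  Only \<open>f''\<close> and \<open>g''\<close>, both in the direction of the second axis, contribute normal components.
  The factor \<open>N $ 2\<close> can be cancelled: orthogonality to the frame gives
  \<open>N = N $ 2 *\<^sub>R (- f', 1, g')\<close>, and \<open>N\<close> is not zero.
\<close>

lemma minimal_translation_II_iff:
  assumes "open I" "open J"
    and f1: "\<And>x. x \<in> I \<Longrightarrow> (f has_real_derivative f' x) (at x)"
    and g1: "\<And>y. y \<in> J \<Longrightarrow> (g has_real_derivative g' y) (at y)"
    and f2: "\<And>x. x \<in> I \<Longrightarrow> (f' has_real_derivative f'' x) (at x)"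
    and g2: "\<And>y. y \<in> J \<Longrightarrow> (g' has_real_derivative g'' y) (at y)"
    and N: "unit_normal_field (translation_II f g) (I \<times> J) N"
  shows "minimal_nabla_bar (translation_II f g) (I \<times> J) N \<longleftrightarrow>
    (\<forall>u\<in>I. \<forall>v\<in>J. ((g' v)\<^sup>2 - 1) * f'' u + (1 + (f' u)\<^sup>2) * g'' v = 0)"
proof -
  let ?T = "translation_II f g"
  have "coeff_G ?T (u, v) * mink (nabla_bar_along ?T (1, 0) (E1 ?T) (u, v)) (N (u, v))
     - coeff_F ?T (u, v) * mink (nabla_bar_along ?T (1, 0) (E2 ?T) (u, v)) (N (u, v))
     - coeff_F ?T (u, v) * mink (nabla_bar_along ?T (0, 1) (E1 ?T) (u, v)) (N (u, v))
     + coeff_E ?T (u, v) * mink (nabla_bar_along ?T (0, 1) (E2 ?T) (u, v)) (N (u, v)) = 0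
     \<longleftrightarrow> ((g' v)\<^sup>2 - 1) * f'' u + (1 + (f' u)\<^sup>2) * g'' v = 0"
    (is "?H = 0 \<longleftrightarrow> ?P = 0") if uv: "u \<in> I" "v \<in> J" for u v
  proof -
    note tan = tangent_translation_II[OF f1[OF uv(1)] g1[OF uv(2)]]
    note tan2 = frechet_derivative_tangent_translation_II[OF assms(1,2) uv f1 g1 f2[OF uv(1)] g2[OF uv(2)]]
    define n where "n = N (u, v)"
    have n: "n $ 1 = - (f' u * n $ 2)" "n $ 3 = g' v * n $ 2" "mink n n = -1"
      using N[unfolded unit_normal_field_def, rule_format, of "(u, v)"] uv
      by (auto simp: tan mink_def n_def[symmetric] algebra_simps)
    have "n $ 2 \<noteq> 0"
      using n by (auto simp: mink_def)
    moreover have "?H = n $ 2 * ?P"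
      by (simp add: coeff_E_def coeff_F_def coeff_G_def nabla_bar_along_def tan tan2 X3_def
          n_def[symmetric] mink_def n(1,2) power2_eq_square algebra_simps)
    ultimately show ?thesis
      by simp
  qed
  then show ?thesis
    by (simp add: minimal_nabla_bar_def)
qed

section \<open>Integration of the separated equations\<close>

lemma eq_up_to_constant:
  fixes f h :: "real \<Rightarrow> real"
  assumes "is_interval S"
    and "\<And>x. x \<in> S \<Longrightarrow> (f has_real_derivative D x) (at x)"
    and "\<And>x. x \<in> S \<Longrightarrow> (h has_real_derivative D x) (at x)"
  shows "\<exists>c. \<forall>x\<in>S. f x = h x + c"
proof -
  have "\<exists>c. \<forall>x\<in>S. f x - h x = c"
  proof (rule has_field_derivative_zero_constant)
    show "convex S"
      using assms(1) by (rule is_interval_convex)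
    show "((\<lambda>x. f x - h x) has_real_derivative 0) (at x within S)" if "x \<in> S" for x
      using DERIV_diff[OF assms(2,3)[OF that]] by (simp add: has_field_derivative_at_within)
  qed
  then show ?thesis
    by (metis add.commute diff_add_cancel)
qed

lemma affine_if_second_derivative_0:
  fixes f :: "real \<Rightarrow> real"
  assumes "is_interval S"
    and "\<And>x. x \<in> S \<Longrightarrow> (f has_real_derivative f' x) (at x)"
    and "\<And>x. x \<in> S \<Longrightarrow> (f' has_real_derivative 0) (at x)"
  obtains c d where "\<And>x. x \<in> S \<Longrightarrow> f x = c * x + d"
proof -
  obtain c where c: "\<And>x. x \<in> S \<Longrightarrow> f' x = 0 + c"
    using eq_up_to_constant[OF assms(1,3), of "\<lambda>_. 0"] by auto
  have "((\<lambda>x. c * x) has_real_derivative f' x) (at x)" if "x \<in> S" for x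
    using c[OF that] by (auto intro!: derivative_eq_intros)
  then obtain d where "\<And>x. x \<in> S \<Longrightarrow> f x = c * x + d"
    using eq_up_to_constant[OF assms(1,2)] by blast
  then show thesis
    by (rule that)
qed

lemma has_real_derivative_ln_abs_comp:
  assumes "(h has_real_derivative D) (at x)" "h x \<noteq> 0"
  shows "((\<lambda>x. ln \<bar>h x\<bar>) has_real_derivative D / h x) (at x)"
proof -
  have "0 < (h x)\<^sup>2"
    using assms(2) by simp
  then have "((\<lambda>x. ln ((h x)\<^sup>2) / 2) has_real_derivative D / h x) (at x)"
    using assms(2) by (auto intro!: derivative_eq_intros assms(1) simp: power2_eq_square field_simps)
  moreover have "ln ((h x)\<^sup>2) / 2 = ln \<bar>h x\<bar>" for x
    using ln_realpow[of "\<bar>h x\<bar>" 2] by (cases "h x = 0") simp_all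
  ultimately show ?thesis
    by simp
qed

lemma has_real_derivative_log_cos:
  assumes "c \<noteq> 0" "cos (c * x + d) \<noteq> 0"
  shows "((\<lambda>x. - ln \<bar>cos (c * x + d)\<bar> / c) has_real_derivative tan (c * x + d)) (at x)"
  by (rule derivative_eq_intros has_real_derivative_ln_abs_comp refl assms)+
    (use assms in \<open>simp add: tan_def\<close>)

lemma has_real_derivative_log_exp_diff:
  assumes "c \<noteq> 0" "exp (c * x) - a * exp (- c * x) \<noteq> 0"
  shows "((\<lambda>x. ln \<bar>exp (c * x) - a * exp (- c * x)\<bar> / c) has_real_derivative
    (exp (c * x) + a * exp (- c * x)) / (exp (c * x) - a * exp (- c * x))) (at x)"
  by (rule derivative_eq_intros has_real_derivative_ln_abs_comp refl assms)+
    (use assms in \<open>simp add: field_simps\<close>)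

text \<open>
  The equation says that \<open>arctan f'\<close> has constant derivative \<open>k\<close>.  Since \<open>arctan\<close> takes values
  strictly between \<open>- pi / 2\<close> and \<open>pi / 2\<close>, the cosine of \<open>k x + d = arctan f'\<close> cannot vanish.
\<close>

lemma solve_tan_equation:
  fixes f :: "real \<Rightarrow> real"
  assumes "is_interval S" "k \<noteq> 0"
    and f1: "\<And>x. x \<in> S \<Longrightarrow> (f has_real_derivative f' x) (at x)"
    and f2: "\<And>x. x \<in> S \<Longrightarrow> (f' has_real_derivative k * (1 + (f' x)\<^sup>2)) (at x)"
  obtains d b where "\<And>x. x \<in> S \<Longrightarrow> cos (k * x + d) \<noteq> 0"
    and "\<And>x. x \<in> S \<Longrightarrow> f x = - ln \<bar>cos (k * x + d)\<bar> / k + b"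
proof -
  have arc: "((\<lambda>x. arctan (f' x)) has_real_derivative k) (at x)" if "x \<in> S" for x
  proof -
    have "1 + (f' x)\<^sup>2 \<noteq> 0"
      by (metis add_pos_nonneg less_irrefl zero_le_power2 zero_less_one)
    then show ?thesis
      using f2[OF that] by (auto intro!: derivative_eq_intros simp: field_simps)
  qed
  have lin: "((\<lambda>x. k * x) has_real_derivative k) (at x)" for x
    by (auto intro!: derivative_eq_intros)
  obtain d where d: "\<And>x. x \<in> S \<Longrightarrow> arctan (f' x) = k * x + d"
    using eq_up_to_constant[OF assms(1) arc lin] by blast
  have f': "f' x = tan (k * x + d)" and cos: "cos (k * x + d) \<noteq> 0" if "x \<in> S" for x
    by (simp_all add: d[OF that, symmetric] tan_arctan)
  have "((\<lambda>x. - ln \<bar>cos (k * x + d)\<bar> / k) has_real_derivative f' x) (at x)" if "x \<in> S" for x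
    unfolding f'[OF that] by (rule has_real_derivative_log_cos[OF assms(2) cos[OF that]])
  then obtain b where "\<And>x. x \<in> S \<Longrightarrow> f x = - ln \<bar>cos (k * x + d)\<bar> / k + b"
    using eq_up_to_constant[OF assms(1) f1] by blast
  with cos show thesis
    by (rule that)
qed

text \<open>
  The Moebius transform of \<open>g'\<close> satisfies a linear equation: the logarithmic derivative of
  \<open>(g' - 1) / (g' + 1)\<close> is \<open>2 g'' / (g'\<^sup>2 - 1) = - 2 k\<close>, so this quotient equals
  \<open>a exp (- 2 k x)\<close>, and solving for \<open>g'\<close> gives the derivative of the logarithm.  The constant
  \<open>a\<close> is positive where \<open>g'\<^sup>2 > 1\<close> (the hyperbolic cotangent) and negative where
  \<open>g'\<^sup>2 < 1\<close> (the hyperbolic tangent).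
\<close>

lemma solve_coth_equation:
  fixes g :: "real \<Rightarrow> real"
  assumes "is_interval S" "k \<noteq> 0"
    and g1: "\<And>x. x \<in> S \<Longrightarrow> (g has_real_derivative g' x) (at x)"
    and g2: "\<And>x. x \<in> S \<Longrightarrow> (g' has_real_derivative - k * ((g' x)\<^sup>2 - 1)) (at x)"
    and ne: "\<And>x. x \<in> S \<Longrightarrow> (g' x)\<^sup>2 \<noteq> 1"
  obtains a b where "a \<noteq> 0"
    and "\<And>x. x \<in> S \<Longrightarrow> exp (k * x) - a * exp (- k * x) \<noteq> 0"
    and "\<And>x. x \<in> S \<Longrightarrow> g x = ln \<bar>exp (k * x) - a * exp (- k * x)\<bar> / k + b"
proof (cases "S = {}")
  case True
  then show thesis
    using that[of 1] by simp
next
  case False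
  then obtain x0 where x0: "x0 \<in> S"
    by blast
  have ne1: "g' x \<noteq> 1" "g' x \<noteq> - 1" if "x \<in> S" for x
    using ne[OF that] by auto
  define w where "w x = exp (2 * (k * x)) * ((g' x - 1) / (g' x + 1))" for x
  have "(w has_real_derivative 0) (at x)" if "x \<in> S" for x
    unfolding w_def using ne1[OF that]
    by (auto intro!: derivative_eq_intros g2[OF that] simp: field_simps power2_eq_square)
  then obtain a where w_eq: "\<And>x. x \<in> S \<Longrightarrow> w x = a"
    using eq_up_to_constant[OF assms(1), of w "\<lambda>_. 0" "\<lambda>_. 0"] by auto
  have w: "a * (g' x + 1) = exp (2 * (k * x)) * (g' x - 1)" if "x \<in> S" for x
  proof -
    have "g' x + 1 \<noteq> 0"
      using ne1[OF that] by (metis add_eq_0_iff2)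
    then show ?thesis
      by (simp add: w_def flip: w_eq[OF that])
  qed
  have a: "a \<noteq> 0"
    using w[OF x0] ne1[OF x0] by auto
  \<comment> \<open>In this form it is visible that \<open>exp (k x) - a exp (- k x)\<close> has no zero:
    at a zero the right-hand side would be \<open>2 exp (k x)\<close>.\<close>
  have eq: "g' x * (exp (k * x) - a * exp (- k * x)) = exp (k * x) + a * exp (- k * x)"
    if "x \<in> S" for x
  proof -
    have "exp (k * x) * (g' x - 1) = exp (- k * x) * (exp (2 * (k * x)) * (g' x - 1))"
      by (simp flip: mult.assoc exp_add)
    also have "\<dots> = a * exp (- k * x) * (g' x + 1)"
      by (simp flip: w[OF that])
    finally show ?thesis
      by (simp add: algebra_simps)
  qed
  have nz: "exp (k * x) - a * exp (- k * x) \<noteq> 0" if "x \<in> S" for x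
  proof
    assume "exp (k * x) - a * exp (- k * x) = 0"
    with eq[OF that] have "2 * exp (k * x) = 0"
      by simp
    then show False
      by simp
  qed
  have "((\<lambda>x. ln \<bar>exp (k * x) - a * exp (- k * x)\<bar> / k) has_real_derivative g' x) (at x)"
    if "x \<in> S" for x
  proof -
    have "g' x = (exp (k * x) + a * exp (- k * x)) / (exp (k * x) - a * exp (- k * x))"
      using eq[OF that] nz[OF that] by (simp add: eq_divide_eq)
    then show ?thesis
      using has_real_derivative_log_exp_diff[OF assms(2) nz[OF that]] by simp
  qed
  then obtain b where "\<And>x. x \<in> S \<Longrightarrow> g x = ln \<bar>exp (k * x) - a * exp (- k * x)\<bar> / k + b"
    using eq_up_to_constant[OF assms(1) g1] by blast
  with a nz show thesis
    by (rule that)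
qed

text \<open>
  The constant \<open>c\<close> absorbs the value of the other summand of \<open>f u + g v\<close> when one variable is held
  fixed.
\<close>

lemma derivative_unique_of_eq_on_open:
  fixes f h :: "real \<Rightarrow> real"
  assumes "open S" "x \<in> S" "(f has_real_derivative D) (at x)"
    and "(h has_real_derivative D') (at x)" "\<And>y. y \<in> S \<Longrightarrow> f y = h y + c"
  shows "D = D'"
proof -
  have "((\<lambda>y. h y + c) has_real_derivative D') (at x)"
    using assms(4) by (auto intro!: derivative_eq_intros)
  then have "(f has_real_derivative D') (at x)"
    by (rule has_field_derivative_transform_within_open[OF _ assms(1,2)]) (simp add: assms(5))
  then show ?thesis
    using assms(3) by (rule DERIV_unique[rotated])
qed

section \<open>Classification of the minimal surfaces\<close>

lemma separate_equation:
  fixes p q r s :: "real \<Rightarrow> real"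
  assumes "\<forall>u\<in>I. \<forall>v\<in>J. q v * p u + r u * s v = 0"
    and "u0 \<in> I" "v0 \<in> J" and "\<And>u. u \<in> I \<Longrightarrow> r u \<noteq> 0" "\<And>v. v \<in> J \<Longrightarrow> q v \<noteq> 0"
  obtains k where "\<And>u. u \<in> I \<Longrightarrow> p u = k * r u" "\<And>v. v \<in> J \<Longrightarrow> s v = - k * q v"
proof
  define k where "k = p u0 / r u0"
  show s: "s v = - k * q v" if "v \<in> J" for v
  proof -
    have "q v * p u0 + r u0 * s v = 0"
      using assms(1,2) that by blast
    then show ?thesis
      using assms(4)[OF assms(2)] by (simp add: k_def field_simps)
  qed
  show "p u = k * r u" if "u \<in> I" for u
  proof -
    have "q v0 * p u + r u * s v0 = 0"
      using assms(1,3) that by blast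
    then have "q v0 * (p u - k * r u) = 0"
      by (simp add: s[OF assms(3)] algebra_simps)
    then show ?thesis
      using assms(5)[OF assms(3)] by simp
  qed
qed

lemma smooth_on_imp_deriv:
  assumes "smooth_on S f" "x \<in> S"
  shows "(f has_real_derivative deriv f x) (at x)"
    and "(deriv f has_real_derivative deriv (deriv f) x) (at x)"
proof -
  have "(deriv ^^ 0) f differentiable at x" "(deriv ^^ 1) f differentiable at x"
    using assms unfolding smooth_on_def by blast+
  then show "(f has_real_derivative deriv f x) (at x)"
    and "(deriv f has_real_derivative deriv (deriv f) x) (at x)"
    by (simp_all add: DERIV_deriv_iff_real_differentiable)
qed

theorem theorem3p4:
  fixes I J :: "real set" and f g :: "real \<Rightarrow> real" and N :: "real \<times> real \<Rightarrow> real^3"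
  assumes "open I" and "is_interval I" and "I \<noteq> {}"
    and "open J" and "is_interval J" and "J \<noteq> {}"
    and "smooth_on I f" and "smooth_on J g"
    and "spacelike_on (translation_II f g) (I \<times> J)"
    and "unit_normal_field (translation_II f g) (I \<times> J) N"
  shows "minimal_nabla_bar (translation_II f g) (I \<times> J) N \<longleftrightarrow>
    (\<exists>c1 c2 c3 :: real. \<forall>u\<in>I. \<forall>v\<in>J.
       translation_II f g (u, v) = vector [u, c1 * u + c2 * v + c3, v]) \<or>
    (\<exists>b c0 c3 c4 :: real. c0 \<noteq> 0 \<and> c3 \<noteq> 0 \<and>
       (\<forall>u\<in>I. cos (c0 * u + c4) \<noteq> 0) \<and>
       (\<forall>v\<in>J. exp (c0 * v) - c3 * exp (- c0 * v) \<noteq> 0) \<and>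
       (\<forall>u\<in>I. \<forall>v\<in>J. translation_II f g (u, v) =
          vector [u,
            1 / c0 * ln (\<bar>exp (c0 * v) - c3 * exp (- c0 * v)\<bar> / \<bar>cos (c0 * u + c4)\<bar>) + b,
            v]))"
    (is "?minimal \<longleftrightarrow> ?plane \<or> ?scherk")
proof -
  obtain u0 v0 where u0: "u0 \<in> I" and v0: "v0 \<in> J"
    using assms(3,6) by blast
  define f' f'' g' g'' where "f' = deriv f" and "f'' = deriv f'" and "g' = deriv g" and "g'' = deriv g'"
  have f1: "(f has_real_derivative f' x) (at x)" and f2: "(f' has_real_derivative f'' x) (at x)"
    if "x \<in> I" for x
    using smooth_on_imp_deriv[OF assms(7) that] by (simp_all add: f'_def f''_def)
  have g1: "(g has_real_derivative g' x) (at x)" and g2: "(g' has_real_derivative g'' x) (at x)"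
    if "x \<in> J" for x
    using smooth_on_imp_deriv[OF assms(8) that] by (simp_all add: g'_def g''_def)
  have minimal_iff: "?minimal \<longleftrightarrow>
      (\<forall>u\<in>I. \<forall>v\<in>J. ((g' v)\<^sup>2 - 1) * f'' u + (1 + (f' u)\<^sup>2) * g'' v = 0)"
    by (rule minimal_translation_II_iff[OF assms(1,4) f1 g1 f2 g2 assms(10)])
  have T_eq_iff: "translation_II f g (u, v) = vector [u, y, v] \<longleftrightarrow> f u + g v = y" for u v y
    by (auto simp: translation_II_def vec_eq_iff forall_3)
  have r: "1 + (f' u)\<^sup>2 \<noteq> 0" for u
    by (metis add_pos_nonneg less_irrefl zero_le_power2 zero_less_one)
  have g'_ne: "(g' v)\<^sup>2 - 1 \<noteq> 0" if "v \<in> J" for v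
    using spacelike_translation_II_imp[OF assms(9) _ f1[OF u0] g1[OF that]] u0 that
      zero_le_power2[of "f' u0"] by auto
  have "?plane \<or> ?scherk" if min: ?minimal
  proof -
    obtain k where k: "\<And>u. u \<in> I \<Longrightarrow> f'' u = k * (1 + (f' u)\<^sup>2)"
        "\<And>v. v \<in> J \<Longrightarrow> g'' v = - k * ((g' v)\<^sup>2 - 1)"
      using separate_equation[OF min[unfolded minimal_iff] u0 v0 r g'_ne] by blast
    show ?thesis
    proof (cases "k = 0")
      case True
      obtain c1 d1 where "\<And>u. u \<in> I \<Longrightarrow> f u = c1 * u + d1"
        using affine_if_second_derivative_0[OF assms(2) f1] f2 k(1) True by auto
      moreover obtain c2 d2 where "\<And>v. v \<in> J \<Longrightarrow> g v = c2 * v + d2"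
        using affine_if_second_derivative_0[OF assms(5) g1] g2 k(2) True by auto
      ultimately have ?plane
        by (intro exI[of _ c1] exI[of _ c2] exI[of _ "d1 + d2"]) (auto simp: T_eq_iff)
      then show ?thesis ..
    next
      case False
      obtain d b1 where f: "\<And>u. u \<in> I \<Longrightarrow> cos (k * u + d) \<noteq> 0"
          "\<And>u. u \<in> I \<Longrightarrow> f u = - ln \<bar>cos (k * u + d)\<bar> / k + b1"
        using solve_tan_equation[OF assms(2) False f1] f2 k(1) by auto
      obtain a b2 where g: "a \<noteq> 0" "\<And>v. v \<in> J \<Longrightarrow> exp (k * v) - a * exp (- k * v) \<noteq> 0"
          "\<And>v. v \<in> J \<Longrightarrow> g v = ln \<bar>exp (k * v) - a * exp (- k * v)\<bar> / k + b2"
        using solve_coth_equation[OF assms(5) False g1] g2 k(2) g'_ne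
        by (metis eq_iff_diff_eq_0)
      have "f u + g v = 1 / k * ln (\<bar>exp (k * v) - a * exp (- k * v)\<bar> / \<bar>cos (k * u + d)\<bar>) + (b1 + b2)"
        if "u \<in> I" "v \<in> J" for u v
        using f[OF that(1)] g(2,3)[OF that(2)] False by (simp add: ln_div field_simps)
      then have ?scherk
        using False f(1) g(1,2)
        by (intro exI[of _ "b1 + b2"] exI[of _ k] exI[of _ a] exI[of _ d]) (simp add: T_eq_iff)
      then show ?thesis ..
    qed
  qed
  moreover have ?minimal if ?plane
  proof -
    from that obtain c1 c2 c3 where c: "\<And>u v. u \<in> I \<Longrightarrow> v \<in> J \<Longrightarrow> f u + g v = c1 * u + c2 * v + c3"
      by (auto simp: T_eq_iff)
    have "f' u = c1" if "u \<in> I" for u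
      by (rule derivative_unique_of_eq_on_open[OF assms(1) that f1[OF that],
            of "\<lambda>u. c1 * u" _ "c2 * v0 + c3 - g v0"])
        (use c[OF _ v0] in \<open>auto intro!: derivative_eq_intros simp: algebra_simps\<close>)
    then have "f'' u = 0" if "u \<in> I" for u
      by (intro derivative_unique_of_eq_on_open[OF assms(1) that f2[OF that],
            of "\<lambda>_. c1" _ 0]) auto
    moreover have "g' v = c2" if "v \<in> J" for v
      by (rule derivative_unique_of_eq_on_open[OF assms(4) that g1[OF that],
            of "\<lambda>v. c2 * v" _ "c1 * u0 + c3 - f u0"])
        (use c[OF u0] in \<open>auto intro!: derivative_eq_intros simp: algebra_simps\<close>)
    then have "g'' v = 0" if "v \<in> J" for v
      by (intro derivative_unique_of_eq_on_open[OF assms(4) that g2[OF that],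
            of "\<lambda>_. c2" _ 0]) auto
    ultimately show ?thesis
      by (simp add: minimal_iff)
  qed
  moreover have ?minimal if ?scherk
  proof -
    from that obtain b k a d where k: "k \<noteq> 0"
      and cos: "\<And>u. u \<in> I \<Longrightarrow> cos (k * u + d) \<noteq> 0"
      and nz: "\<And>v. v \<in> J \<Longrightarrow> exp (k * v) - a * exp (- k * v) \<noteq> 0"
      and eq0: "\<And>u v. u \<in> I \<Longrightarrow> v \<in> J \<Longrightarrow>
        f u + g v = 1 / k * ln (\<bar>exp (k * v) - a * exp (- k * v)\<bar> / \<bar>cos (k * u + d)\<bar>) + b"
      unfolding T_eq_iff by blast
    then have eq: "f u + g v =
        - ln \<bar>cos (k * u + d)\<bar> / k + ln \<bar>exp (k * v) - a * exp (- k * v)\<bar> / k + b"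
      if "u \<in> I" "v \<in> J" for u v
      using cos[OF that(1)] nz[OF that(2)] k by (simp add: eq0[OF that] ln_div diff_divide_distrib)
    have f': "f' u = tan (k * u + d)" if "u \<in> I" for u
      by (rule derivative_unique_of_eq_on_open[OF assms(1) that f1[OF that]
            has_real_derivative_log_cos[OF k cos[OF that]],
            of "ln \<bar>exp (k * v0) - a * exp (- k * v0)\<bar> / k + b - g v0"])
        (use eq[OF _ v0] in \<open>simp add: algebra_simps\<close>)
    have f'': "f'' u = k * (1 + (f' u)\<^sup>2)" if "u \<in> I" for u
      by (rule derivative_unique_of_eq_on_open[OF assms(1) that f2[OF that],
            of "\<lambda>u. tan (k * u + d)" _ 0])
        (use cos[OF that] in \<open>auto intro!: derivative_eq_intros
           simp: f' that tan_sec power_inverse divide_inverse\<close>)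
    let ?e = "\<lambda>v. exp (k * v) - a * exp (- k * v)"
    have g': "g' v = (exp (k * v) + a * exp (- k * v)) / ?e v" if "v \<in> J" for v
      by (rule derivative_unique_of_eq_on_open[OF assms(4) that g1[OF that]
            has_real_derivative_log_exp_diff[OF k nz[OF that]],
            of "- ln \<bar>cos (k * u0 + d)\<bar> / k + b - f u0"])
        (use eq[OF u0] in \<open>simp add: algebra_simps\<close>)
    have g'': "g'' v = - k * ((g' v)\<^sup>2 - 1)" if "v \<in> J" for v
    proof (rule derivative_unique_of_eq_on_open[OF assms(4) that g2[OF that],
            of "\<lambda>v. (exp (k * v) + a * exp (- k * v)) / ?e v" _ 0])
      show "((\<lambda>v. (exp (k * v) + a * exp (- k * v)) / ?e v) has_real_derivative
          - k * ((g' v)\<^sup>2 - 1)) (at v)"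
        by (rule derivative_eq_intros refl nz[OF that])+
          (use nz[OF that] in \<open>simp add: g'[OF that] divide_simps power2_eq_square, simp add: algebra_simps\<close>)
    qed (simp add: g')
    show ?thesis
      by (simp add: minimal_iff f'' g'' algebra_simps)
  qed
  ultimately show ?thesis
    by blast
qed

end
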